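(* Let $L,G,D,\delta,\beta,K>0$ be constants and suppose that $\sigma\in C^2(\mathbb{R})$ is strictly decreasing. Then the only (smooth positive) steady states of the system \begin{align*} &\partial_t h-\partial_x\Big(\tfrac{G}{3}h^3\partial_x h-\tfrac12 h^2\partial_x\sigma(\Gamma)\Big)=0,\\ &\partial_t m-\partial_x\Big(\tfrac{G}{3}h^2 m\,\partial_x h-\tfrac12 h\,m\,\partial_x\sigma(\Gamma)+\delta\,\partial_x m-\delta\,\tfrac{m}{h}\,\partial_x h\Big)=-K\Big(\tfrac{\beta m}{h}-\Gamma\Big),\\ &\partial_t\Gamma-\partial_x\Big(\tfrac{G}{2}h^2\,\Gamma\,\partial_x h-h\,\Gamma\,\partial_x\sigma(\Gamma)+D\,\partial_x\Gamma\Big)=K\Big(\tfrac{\beta m}{h}-\Gamma\Big) \end{align*} for $x\in(0,L)$, with boundary conditions $\partial_x h=\partial_x m=\partial_x\Gamma=0$ at $x=0,L$, are of the form $(h_*,m_*,\Gamma_* )$ with constants $h_*>0$ and $m_*=h_*\Gamma_*/\beta>0$.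
   Context: A (smooth positive) steady state is a time-independent solution $(h,m,\Gamma)$ of the system, i.e. a triple of functions of $x$ alone satisfying the equations with all time derivatives equal to zero together with the boundary conditions, where $h,m,\Gamma$ are strictly positive on $[0,L]$ and belong to $H^2((0,L))$. *)

theory Defs
  imports "HOL-Analysis.Analysis"
begin

definition C_k :: "nat \<Rightarrow> (real \<Rightarrow> real) \<Rightarrow> bool" where
  "C_k k f \<longleftrightarrow>
     (\<forall>j<k. (deriv ^^ j) f differentiable_on UNIV) \<and> continuous_on UNIV ((deriv ^^ k) f)"

definition test_function :: "real set \<Rightarrow> (real \<Rightarrow> real) \<Rightarrow> bool" where
  "test_function \<Omega> \<phi> \<longleftrightarrow>
     (\<forall>k. C_k k \<phi>) \<and> (\<exists>S. compact S \<and> S \<subseteq> \<Omega> \<and> (\<forall>x. x \<notin> S \<longrightarrow> \<phi> x = 0))"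

definition locally_integrable_on :: "(real \<Rightarrow> real) \<Rightarrow> real set \<Rightarrow> bool" where
  "locally_integrable_on f \<Omega> \<longleftrightarrow> (\<forall>S. compact S \<and> S \<subseteq> \<Omega> \<longrightarrow> set_integrable lebesgue S f)"

definition has_weak_deriv_on :: "(real \<Rightarrow> real) \<Rightarrow> (real \<Rightarrow> real) \<Rightarrow> real set \<Rightarrow> bool" where
  "has_weak_deriv_on f g \<Omega> \<longleftrightarrow>
     locally_integrable_on f \<Omega> \<and> locally_integrable_on g \<Omega> \<and>
     (\<forall>\<phi>. test_function \<Omega> \<phi> \<longrightarrow>
        (LINT x:\<Omega>|lebesgue. f x * deriv \<phi> x) = - (LINT x:\<Omega>|lebesgue. g x * \<phi> x))"

definition L2_space :: "real set \<Rightarrow> (real \<Rightarrow> real) set" where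
  "L2_space \<Omega> =
     {f. f \<in> borel_measurable (lebesgue_on \<Omega>) \<and> integrable (lebesgue_on \<Omega>) (\<lambda>x. (f x)\<^sup>2)}"

primrec sobolev_H :: "nat \<Rightarrow> real set \<Rightarrow> (real \<Rightarrow> real) set" where
  "sobolev_H 0 \<Omega> = L2_space \<Omega>"
| "sobolev_H (Suc k) \<Omega> =
     {f \<in> L2_space \<Omega>. \<exists>g \<in> sobolev_H k \<Omega>. has_weak_deriv_on f g \<Omega>}"

text \<open>
  Elements of \<open>H\<^sup>2((0,L))\<close> are classes modulo null sets; each class has a unique representative that
  is continuous on \<open>[0,L]\<close>, and this is the one meant by \<open>h\<close>, \<open>m\<close>, \<open>\<Gamma>\<close> below. Their values outside
  \<open>[0,L]\<close> are irrelevant. Likewise \<open>hx\<close>, \<open>mx\<close>, \<open>\<Gamma>x\<close> are the continuous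
  representatives of the first derivatives (recall that \<open>H\<^sup>2((0,L))\<close> embeds into \<open>C\<^sup>1([0,L])\<close>), so that
  the boundary conditions are statements about point values. Weak derivatives are unique up to null
  sets; hence binding \<open>hx\<close>, \<open>mx\<close>, \<open>\<Gamma>x\<close>, the derivative \<open>sx\<close> of \<open>\<sigma>(\<Gamma>)\<close> and the derivatives
  \<open>J1\<close>, \<open>J2\<close>, \<open>J3\<close> of the fluxes existentially involves no choice, and the equations are
  required almost everywhere in \<open>(0,L)\<close>.
\<close>

definition steady_state ::
  "real \<Rightarrow> real \<Rightarrow> real \<Rightarrow> real \<Rightarrow> real \<Rightarrow> real \<Rightarrow> (real \<Rightarrow> real) \<Rightarrow>
   (real \<Rightarrow> real) \<Rightarrow> (real \<Rightarrow> real) \<Rightarrow> (real \<Rightarrow> real) \<Rightarrow> bool" where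
  "steady_state L G D \<delta> \<beta> K \<sigma> h m \<Gamma> \<longleftrightarrow>
     h \<in> sobolev_H 2 {0<..<L} \<and> m \<in> sobolev_H 2 {0<..<L} \<and> \<Gamma> \<in> sobolev_H 2 {0<..<L} \<and>
     continuous_on {0..L} h \<and> continuous_on {0..L} m \<and> continuous_on {0..L} \<Gamma> \<and>
     (\<forall>x\<in>{0..L}. h x > 0 \<and> m x > 0 \<and> \<Gamma> x > 0) \<and>
     (\<exists>hx mx \<Gamma>x sx J1 J2 J3.
        has_weak_deriv_on h hx {0<..<L} \<and> continuous_on {0..L} hx \<and>
        has_weak_deriv_on m mx {0<..<L} \<and> continuous_on {0..L} mx \<and>
        has_weak_deriv_on \<Gamma> \<Gamma>x {0<..<L} \<and> continuous_on {0..L} \<Gamma>x \<and>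
        has_weak_deriv_on (\<lambda>x. \<sigma> (\<Gamma> x)) sx {0<..<L} \<and>
        has_weak_deriv_on
          (\<lambda>x. G / 3 * h x ^ 3 * hx x - 1 / 2 * h x ^ 2 * sx x)
          J1 {0<..<L} \<and>
        has_weak_deriv_on
          (\<lambda>x. G / 3 * h x ^ 2 * m x * hx x - 1 / 2 * h x * m x * sx x
               + \<delta> * mx x - \<delta> * (m x / h x) * hx x)
          J2 {0<..<L} \<and>
        has_weak_deriv_on
          (\<lambda>x. G / 2 * h x ^ 2 * \<Gamma> x * hx x - h x * \<Gamma> x * sx x + D * \<Gamma>x x)
          J3 {0<..<L} \<and>
        (AE x in lebesgue_on {0<..<L}. - J1 x = 0) \<and>
        (AE x in lebesgue_on {0<..<L}. - J2 x = - K * (\<beta> * m x / h x - \<Gamma> x)) \<and>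
        (AE x in lebesgue_on {0<..<L}. - J3 x = K * (\<beta> * m x / h x - \<Gamma> x)) \<and>
        hx 0 = 0 \<and> hx L = 0 \<and> mx 0 = 0 \<and> mx L = 0 \<and> \<Gamma>x 0 = 0 \<and> \<Gamma>x L = 0)"

end

theory Submission
  imports Defs
begin

text \<open>
  Since \<open>H\<^sup>2\<close> functions and fluxes with continuous weak derivatives are classically differentiable,
  a steady state solves a system of ODEs. The first flux is constant, hence zero by the boundary
  conditions, so \<open>2 G h h' = 3 \<sigma>'(\<Gamma>) \<Gamma>'\<close>. Substituting this, the second flux becomes
  \<open>F2 = \<delta> h (m / h)'\<close> and the third \<open>F3 = (D - h \<Gamma> \<sigma>'(\<Gamma>) / 4) \<Gamma>'\<close>, where the coefficient is positive
  because \<open>\<sigma>' \<le> 0\<close>. The sum \<open>F2 + F3\<close> is constant, hence zero. With \<open>w = \<beta> m / h - \<Gamma>\<close> this gives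
  \<open>F2' = K w\<close> and \<open>w' = b F2\<close> for some \<open>b > 0\<close>, so that \<open>(F2 w)' = K w\<^sup>2 + b F2\<^sup>2\<close>. As \<open>F2\<close> vanishes at
  both ends, \<open>F2 = w = 0\<close>, and \<open>\<Gamma>\<close>, \<open>h\<close>, \<open>m\<close> are constant.
\<close>

section \<open>Smooth bump functions\<close>

text \<open>Smoothness without computing iterated derivatives: in a family stable under
  differentiation, every \<open>(deriv ^^ j) f\<close> is again a member, hence
  differentiable.\<close>

lemma C_k_if_deriv_closed:
  assumes "f \<in> F"
    and "\<And>g. g \<in> F \<Longrightarrow> \<exists>g'\<in>F. \<forall>x. (g has_real_derivative g' x) (at x)"
  shows "C_k k f"
proof -
  have cl: "deriv g \<in> F \<and> g differentiable_on UNIV" if g: "g \<in> F" for g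
  proof -
    obtain g' where "g' \<in> F" and d: "\<And>x. (g has_real_derivative g' x) (at x)"
      using assms(2)[OF g] by blast
    moreover have "deriv g = g'" using d by (intro ext DERIV_imp_deriv)
    ultimately show ?thesis
      by (auto simp: differentiable_on_def real_differentiable_def)
  qed
  have "(deriv ^^ j) f \<in> F" for j
    by (induction j) (auto simp: cl assms(1))
  then show ?thesis
    unfolding C_k_def using cl differentiable_imp_continuous_on by blast
qed

lemma C_k_all_has_deriv:
  assumes "\<And>k. C_k k f"
  shows "(f has_real_derivative deriv f x) (at x)"
proof -
  have "f differentiable_on UNIV"
    using assms[of 1] by (simp add: C_k_def)
  then show ?thesis
    by (auto simp: differentiable_on_def DERIV_deriv_iff_real_differentiable)
qed

lemma C_k_deriv:
  assumes "C_k (Suc k) f"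
  shows "C_k k (deriv f)"
proof -
  have "(deriv ^^ j) (deriv f) = (deriv ^^ Suc j) f" for j
    by (simp add: funpow_swap1)
  then show ?thesis
    using assms unfolding C_k_def by (metis Suc_less_eq)
qed

lemma C_k_all_continuous:
  assumes "\<And>k. C_k k f"
  shows "continuous_on A f"
  using C_k_all_has_deriv[OF assms] by (meson DERIV_continuous_on has_field_derivative_at_within)

text \<open>The smooth functions are stable under \<open>deriv\<close>, and they stay so when
  \<open>g\<close> is added, because its derivative \<open>f\<close> is one of them.\<close>

lemma C_k_all_antideriv:
  assumes "\<And>k. C_k k f" "\<And>x. (g has_real_derivative f x) (at x)"
  shows "C_k k g"
proof (rule C_k_if_deriv_closed[where F = "insert g {f. \<forall>k. C_k k f}"])
  fix u assume "u \<in> insert g {f. \<forall>k. C_k k f}"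
  then consider "u = g" | "\<forall>k. C_k k u" by blast
  then show "\<exists>u'\<in>insert g {f. \<forall>k. C_k k f}. \<forall>x. (u has_real_derivative u' x) (at x)"
  proof cases
    case 1
    then show ?thesis using assms by blast
  next
    case 2
    then show ?thesis
      by (intro bexI[of _ "deriv u"]) (auto intro: C_k_all_has_deriv C_k_deriv)
  qed
qed simp

lemma C_k_all_diff_scaled:
  assumes "\<And>k. C_k k f" "\<And>k. C_k k g"
  shows "C_k k (\<lambda>x. f x - c * g x)"
proof (rule C_k_if_deriv_closed[where F = "{\<lambda>x. f x - c * g x |f g. (\<forall>k. C_k k f) \<and> (\<forall>k. C_k k g)}"])
  fix u assume "u \<in> {\<lambda>x. f x - c * g x |f g. (\<forall>k. C_k k f) \<and> (\<forall>k. C_k k g)}"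
  then obtain f g where u: "u = (\<lambda>x. f x - c * g x)" and fg: "\<And>k. C_k k f" "\<And>k. C_k k g"
    by auto
  have "\<forall>x. (u has_real_derivative deriv f x - c * deriv g x) (at x)"
    unfolding u using fg by (auto intro!: derivative_eq_intros C_k_all_has_deriv)
  moreover have "\<And>k. C_k k (deriv f)" "\<And>k. C_k k (deriv g)"
    using fg by (simp_all add: C_k_deriv)
  ultimately show "\<exists>u'\<in>{\<lambda>x. f x - c * g x |f g. (\<forall>k. C_k k f) \<and> (\<forall>k. C_k k g)}.
    \<forall>x. (u has_real_derivative u' x) (at x)"
    by (intro bexI[of _ "\<lambda>x. deriv f x - c * deriv g x"]) blast+
qed (use assms in auto)

text \<open>The derivatives of \<open>exp (- 1 / q)\<close> on \<open>q > 0\<close> for a polynomial \<open>q\<close> are of the form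
  \<open>p * exp (- 1 / q) / q ^ n\<close>, which is why the exponent \<open>n\<close> is carried along.\<close>

definition flat :: "nat \<Rightarrow> real \<Rightarrow> real" where
  "flat n t = (if t > 0 then exp (- 1 / t) / t ^ n else 0)"

text \<open>Raising the exponent at the price of a factor \<open>t ^ k\<close> allows terms with
  different exponents to be collected over a common one.\<close>

lemma flat_mult_power: "flat n t = flat (n + k) t * t ^ k"
  by (auto simp: flat_def power_add)

text \<open>On the right of 0, the substitution \<open>s = 1 / t\<close> turns the claim into the
  decay of \<open>s ^ n / exp s\<close> at infinity; on the left the function vanishes
  identically.\<close>

lemma flat_tendsto_0: "(flat n \<longlongrightarrow> 0) (at 0)"
proof -
  have "((\<lambda>t::real. inverse t ^ n / exp (inverse t)) \<longlongrightarrow> 0) (at_right 0)"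
    by (rule filterlim_compose[OF tendsto_power_div_exp_0 filterlim_inverse_at_top_right])
  then have "(flat n \<longlongrightarrow> 0) (at_right 0)"
  proof (rule Lim_transform_eventually)
    show "\<forall>\<^sub>F t in at_right 0. inverse t ^ n / exp (inverse t) = flat n t"
      using eventually_at_right_less[of 0]
      by eventually_elim (auto simp: flat_def exp_minus field_simps)
  qed
  moreover have "(flat n \<longlongrightarrow> 0) (at_left 0)"
  proof (rule tendsto_eventually)
    show "\<forall>\<^sub>F t in at_left 0. flat n t = 0"
      by (auto simp: eventually_at_filter flat_def)
  qed
  ultimately show ?thesis by (simp add: filterlim_at_split)
qed

lemma flat_has_deriv:
  "(flat n has_real_derivative flat (n + 2) t - real n * flat (n + 1) t) (at t)"
proof (cases "t = 0")
  case True
  \<comment> \<open>The difference quotient at 0 is again a function of the same family, so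
    differentiability at 0 reduces to the limit already known.\<close>
  have "(\<lambda>h. (flat n (0 + h) - flat n 0) / h) = flat (n + 1)"
    by (auto simp: flat_def fun_eq_iff)
  then have "(flat n has_real_derivative 0) (at 0)"
    unfolding DERIV_def using flat_tendsto_0[of "n + 1"] by simp
  then show ?thesis using True by (simp add: flat_def)
next
  case False
  consider "t > 0" | "t < 0" using False by linarith
  then show ?thesis
  proof cases
    case 1
    have "((\<lambda>t. exp (- 1 / t) / t ^ n) has_real_derivative
      flat (n + 2) t - real n * flat (n + 1) t) (at t)"
    proof (cases n)
      case (Suc k)
      then show ?thesis
        using 1 by (auto intro!: derivative_eq_intros
          simp: flat_def field_simps power2_eq_square) (cases k; simp)
    qed (use 1 in \<open>auto intro!: derivative_eq_intros simp: flat_def power2_eq_square\<close>)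
    then show ?thesis
    proof (rule has_field_derivative_transform_within_open[where S = "{0<..}"])
      show "exp (- 1 / x) / x ^ n = flat n x" if "x \<in> {0<..}" for x
        using that by (simp add: flat_def)
    qed (use 1 in auto)
  next
    case 2
    have "((\<lambda>t. 0) has_real_derivative flat (n + 2) t - real n * flat (n + 1) t) (at t)"
      using 2 by (simp add: flat_def)
    then show ?thesis
    proof (rule has_field_derivative_transform_within_open[where S = "{..<0}"])
      show "0 = flat n x" if "x \<in> {..<0}" for x
        using that by (simp add: flat_def)
    qed (use 2 in auto)
  qed
qed

text \<open>The family stable under differentiation consists of the products of a polynomial with
  some \<open>flat n\<close> composed with the fixed polynomial \<open>q\<close>.\<close>

lemma C_k_flat_poly: "C_k k (\<lambda>x. flat 0 (poly q x))"
proof (rule C_k_if_deriv_closed[where F = "{\<lambda>x. poly p x * flat n (poly q x) |p n. True}"])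
  show "(\<lambda>x. flat 0 (poly q x)) \<in> {\<lambda>x. poly p x * flat n (poly q x) |p n. True}"
    by (rule CollectI, rule exI[of _ 1], rule exI[of _ 0]) simp
next
  fix g assume "g \<in> {\<lambda>x. poly p x * flat n (poly q x) |p n. True}"
  then obtain p n where g: "g = (\<lambda>x. poly p x * flat n (poly q x))" by auto
  \<comment> \<open>The product and chain rules give terms with exponents \<open>n\<close>,
    \<open>n + 1\<close> and \<open>n + 2\<close>; over the common exponent \<open>n + 2\<close> the
    first gains the factor \<open>q ^ 2\<close> and the second the factor \<open>q\<close>.\<close>
  define r where
    "r = pderiv p * q ^ 2 + p * pderiv q - smult (real n) (p * pderiv q * q)"
  have "(g has_real_derivative poly r x * flat (n + 2) (poly q x)) (at x)" for x
    unfolding g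
    by (rule derivative_eq_intros DERIV_chain2[OF flat_has_deriv] poly_DERIV refl)+
       (use flat_mult_power[of n "poly q x" 2] flat_mult_power[of "n+1" "poly q x" 1] in
         \<open>simp add: r_def algebra_simps\<close>)
  then show "\<exists>g'\<in>{\<lambda>x. poly p x * flat n (poly q x) |p n. True}.
      \<forall>x. (g has_real_derivative g' x) (at x)"
    by (intro bexI[of _ "\<lambda>x. poly r x * flat (n + 2) (poly q x)"]) auto
qed

text \<open>Inside the interval this is \<open>exp (- 1 / (Suc n * (x - a) * (b - x)))\<close>. The
  growing factor drives the exponent to 0, so the bumps approximate the indicator of
  \<open>{a<..<b}\<close>; \<open>Suc n\<close> keeps the factor positive already for
  \<open>n = 0\<close>.\<close>

definition bump :: "real \<Rightarrow> real \<Rightarrow> nat \<Rightarrow> real \<Rightarrow> real" where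
  "bump a b n x = flat 0 (real (Suc n) * ((x - a) * (b - x)))"

lemma C_k_bump: "C_k k (bump a b n)"
proof -
  have "bump a b n = (\<lambda>x. flat 0 (poly (smult (real (Suc n)) ([:- a, 1:] * [:b, - 1:])) x))"
    by (auto simp: bump_def fun_eq_iff algebra_simps)
  then show ?thesis using C_k_flat_poly by metis
qed

lemma bump_eq_0:
  assumes "x \<notin> {a<..<b}" "a < b"
  shows "bump a b n x = 0"
proof -
  have "\<not> 0 < (x - a) * (b - x)"
    using assms by (auto simp: zero_less_mult_iff)
  then show ?thesis
    by (simp add: bump_def flat_def zero_less_mult_iff del: of_nat_Suc)
qed

lemma bump_pos: "x \<in> {a<..<b} \<Longrightarrow> bump a b n x > 0"
  by (simp add: bump_def flat_def)

lemma abs_bump_le_1: "\<bar>bump a b n x\<bar> \<le> 1"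
  unfolding bump_def flat_def by (auto simp del: of_nat_Suc)

lemma bump_tendsto_indicator:
  assumes "a < b"
  shows "(\<lambda>n. bump a b n x) \<longlonglongrightarrow> indicator {a<..<b} x"
proof (cases "x \<in> {a<..<b}")
  case True
  then have pos: "(x - a) * (b - x) > 0" by simp
  have "(\<lambda>n. exp (- (1 / ((x - a) * (b - x))) * inverse (real (Suc n)))) \<longlonglongrightarrow> exp (- (1 / ((x - a) * (b - x))) * 0)"
    by (intro tendsto_intros LIMSEQ_inverse_real_of_nat)
  moreover have "exp (- (1 / ((x - a) * (b - x))) * inverse (real (Suc n))) = bump a b n x" for n
    using mult_pos_pos[OF _ pos, of "real (Suc n)"]
    by (simp add: bump_def flat_def divide_inverse mult_ac del: of_nat_Suc)
  ultimately show ?thesis using True by simp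
qed (use assms in \<open>simp add: bump_eq_0\<close>)

lemma test_function_bump:
  assumes "a < b" "{a..b} \<subseteq> S"
  shows "test_function S (bump a b n)"
  unfolding test_function_def
  using assms bump_eq_0[of _ a b n] C_k_bump by (auto intro!: exI[of _ "{a..b}"])

section \<open>The fundamental lemma of the calculus of variations\<close>

text \<open>Open intervals are an intersection-stable generator of the Borel sets, so Dynkin
  induction extends vanishing integrals to all Borel sets, and completion to all Lebesgue sets.
  Uniqueness of densities then compares \<open>u\<close> with 0.\<close>

lemma AE_eq_0_if_interval_integrals_eq_0:
  fixes u :: "real \<Rightarrow> real"
  assumes int: "integrable lebesgue u"
    and 0: "\<And>c d. (LINT x:{c<..<d}|lebesgue. u x) = 0"
  shows "AE x in lebesgue. u x = 0"
proof (rule density_unique_real[OF int integrable_zero])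
  have setint: "set_integrable lebesgue A u" if "A \<in> sets lebesgue" for A
    unfolding set_integrable_def using int that by (rule integrable_mult_indicator[rotated])
  \<comment> \<open>The integral over the whole line settles complements in the Dynkin induction; it
    is the limit of the integrals over growing intervals.\<close>
  have total: "(LINT x|lebesgue. u x) = 0"
  proof (rule LIMSEQ_unique)
    show "(\<lambda>n. LINT x|lebesgue. indicator {- real n<..<real n} x *\<^sub>R u x) \<longlonglongrightarrow> (LINT x|lebesgue. u x)"
    proof (rule integral_dominated_convergence[where w = "\<lambda>x. norm (u x)"])
      show "AE x in lebesgue. (\<lambda>n. indicator {- real n<..<real n} x *\<^sub>R u x) \<longlonglongrightarrow> u x"
      proof (rule AE_I2, rule tendsto_eventually)
        fix x :: real
        obtain N where N: "\<bar>x\<bar> < real N" using reals_Archimedean2 by blast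
        show "\<forall>\<^sub>F n in sequentially. indicator {- real n<..<real n} x *\<^sub>R u x = u x"
          using eventually_ge_at_top[of N] by eventually_elim (use N in \<open>auto simp: indicator_def\<close>)
      qed
      show "(\<lambda>x. indicator {- real n<..<real n} x *\<^sub>R u x) \<in> borel_measurable lebesgue" for n
        using setint[of "{- real n<..<real n}"] unfolding set_integrable_def
        by (intro borel_measurable_integrable) auto
    qed (use int in \<open>auto simp: indicator_def\<close>)
    show "(\<lambda>n. LINT x|lebesgue. indicator {- real n<..<real n} x *\<^sub>R u x) \<longlonglongrightarrow> 0"
      using 0 by (simp add: set_lebesgue_integral_def)
  qed
  have borel: "(LINT x:A|lebesgue. u x) = 0" if "A \<in> sets borel" for A
  proof -
    have gen: "sets borel = sigma_sets UNIV (range (\<lambda>(c::real, d). {c<..<d}))"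
      using arg_cong[OF borel_eq_box[where 'a = real], of sets] by simp
    have "Int_stable (range (\<lambda>(c::real, d). {c<..<d}))"
    proof (rule Int_stableI_image)
      fix i j :: "real \<times> real"
      show "\<exists>k\<in>UNIV. (case i of (c, d) \<Rightarrow> {c<..<d}) \<inter> (case j of (c, d) \<Rightarrow> {c<..<d})
          = (case k of (c, d) \<Rightarrow> {c<..<d})"
        by (intro bexI[of _ "(max (fst i) (fst j), min (snd i) (snd j))"]) auto
    qed
    moreover have "range (\<lambda>(c::real, d). {c<..<d}) \<subseteq> Pow UNIV" by simp
    moreover have "A \<in> sigma_sets UNIV (range (\<lambda>(c::real, d). {c<..<d}))"
      using that gen by simp
    ultimately show ?thesis
    proof (induction rule: sigma_sets_induct_disjoint)
      case (basic A)
      then show ?case using 0 by auto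
    next
      case (compl A)
      then have [measurable]: "A \<in> sets lebesgue" using gen by auto
      have "(LINT x|lebesgue. u x) = (LINT x:A|lebesgue. u x) + (LINT x:UNIV - A|lebesgue. u x)"
        using set_integral_Un[of A "UNIV - A" lebesgue u] setint sets.compl_sets[of A lebesgue]
        by (simp add: set_lebesgue_integral_def)
      then show ?case using compl total by simp
    next
      case (union A)
      then have "A i \<in> sets borel" for i using gen by auto
      then have [intro]: "A i \<in> sets lebesgue" for i by simp
      have "(LINT x:\<Union>(range A)|lebesgue. u x) = (\<Sum>i. LINT x:A i|lebesgue. u x)"
        using union(1) by (intro lebesgue_integral_countable_add setint)
          (auto simp: disjoint_family_on_def)
      then show ?case using union by simp
    qed (simp add: set_lebesgue_integral_def)
  qed
  \<comment> \<open>Uniqueness of densities asks for every Lebesgue set; such a set differs from a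
    Borel set \<open>S\<close> by part of a null set only.\<close>
  fix A :: "real set" assume A: "A \<in> sets lebesgue"
  then obtain S N N' where S: "A = S \<union> N" "N \<subseteq> N'" "N' \<in> null_sets lborel" "S \<in> sets lborel"
    by (rule sets_completionE)
  have "(LINT x:A|lebesgue. u x) = (LINT x:S|lebesgue. u x)"
    unfolding set_lebesgue_integral_def
  proof (rule integral_cong_AE)
    have "N' \<in> null_sets lebesgue" using S(3) by (simp add: null_sets_completionI)
    then have "AE x in lebesgue. x \<notin> N'" by (rule AE_not_in)
    then show "AE x in lebesgue. indicator A x *\<^sub>R u x = indicator S x *\<^sub>R u x"
      by eventually_elim (use S in \<open>auto simp: indicator_def\<close>)
  qed (use setint[of A] setint[of S] A S(4) in
      \<open>auto simp: set_integrable_def dest: borel_measurable_integrable\<close>)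
  then show "(LINT x:A|lebesgue. u x) = (LINT x:A|lebesgue. 0)" using borel S(4) by simp
qed

text \<open>On the compact set \<open>S\<close> the continuous factor is bounded by some
  \<open>C\<close>, and off \<open>S\<close> the product vanishes, so
  \<open>C * \<bar>f\<bar>\<close> restricted to \<open>S\<close> dominates it.\<close>

lemma set_integrable_mult_compact_support:
  fixes f \<phi> :: "real \<Rightarrow> real"
  assumes f: "locally_integrable_on f \<Omega>" and S: "compact S" "S \<subseteq> \<Omega>"
    and \<phi>: "continuous_on UNIV \<phi>" "\<And>x. x \<notin> S \<Longrightarrow> \<phi> x = 0"
  shows "set_integrable lebesgue \<Omega> (\<lambda>x. f x * \<phi> x)"
proof -
  have "bounded (\<phi> ` S)"
    using S \<phi> by (meson compact_continuous_image compact_imp_bounded continuous_on_subset top_greatest)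
  then obtain C where C: "\<And>x. x \<in> S \<Longrightarrow> \<bar>\<phi> x\<bar> \<le> C"
    by (auto simp: bounded_iff)
  have eq: "indicator \<Omega> x *\<^sub>R (f x * \<phi> x) = indicator S x *\<^sub>R f x * \<phi> x" for x
    using S \<phi>(2) by (auto simp: indicator_def)
  have fS: "integrable lebesgue (\<lambda>x. indicator S x *\<^sub>R f x)"
    using f S by (simp add: locally_integrable_on_def set_integrable_def)
  have [measurable]: "\<phi> \<in> borel_measurable lebesgue"
    using \<phi>(1) by (intro measurable_completion) (simp add: borel_measurable_continuous_onI)
  show ?thesis
    unfolding set_integrable_def eq
  proof (rule Bochner_Integration.integrable_bound)
    show "integrable lebesgue (\<lambda>x. C * \<bar>indicator S x *\<^sub>R f x\<bar>)"
      using fS by (intro integrable_mult_right integrable_abs) auto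
    show "(\<lambda>x. indicat_real S x *\<^sub>R f x * \<phi> x) \<in> borel_measurable lebesgue"
      using fS by measurable
    show "AE x in lebesgue. norm (indicat_real S x *\<^sub>R f x * \<phi> x)
        \<le> norm (C * \<bar>indicat_real S x *\<^sub>R f x\<bar>)"
      using C by (intro AE_I2) (fastforce simp: indicator_def abs_mult mult.commute
        intro: mult_right_mono order_trans[OF _ abs_ge_self] split: if_splits)
  qed
qed

text \<open>Subintervals with rational endpoints cover \<open>{a<..<b}\<close>, and countably many
  null sets unite to a null set. This permits working on compact subintervals, where a locally
  integrable function is integrable.\<close>

lemma AE_eq_0_on_interval:
  fixes a b :: real
  assumes "\<And>c d. a < c \<Longrightarrow> c < d \<Longrightarrow> d < b \<Longrightarrow> AE x in lebesgue. x \<in> {c<..<d} \<longrightarrow> P x"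
  shows "AE x in lebesgue. x \<in> {a<..<b} \<longrightarrow> P x"
proof -
  have "AE x in lebesgue. \<forall>p\<in>\<rat> \<times> \<rat>. a < fst p \<and> fst p < snd p \<and> snd p < b \<longrightarrow> x \<in> {fst p<..<snd p} \<longrightarrow> P x"
    by (subst AE_ball_countable) (use assms in \<open>auto intro!: countable_SIGMA countable_rat\<close>)
  then show ?thesis
  proof eventually_elim
    case (elim x)
    show ?case
    proof
      assume x: "x \<in> {a<..<b}"
      then obtain c d where "c \<in> \<rat>" "a < c" "c < x" "d \<in> \<rat>" "x < d" "d < b"
        using Rats_dense_in_real[of a x] Rats_dense_in_real[of x b] by auto
      then show "P x" using elim[rule_format, of "(c, d)"] by auto
    qed
  qed
qed

text \<open>Bumps are admissible test functions tending boundedly to indicators of intervals, so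
  \<open>u\<close> integrates to 0 over every small interval.\<close>

lemma fundamental_lemma_calculus_of_variations:
  fixes u :: "real \<Rightarrow> real"
  assumes u: "locally_integrable_on u {a<..<b}"
    and 0: "\<And>\<phi>. test_function {a<..<b} \<phi> \<Longrightarrow> (LINT x:{a<..<b}|lebesgue. u x * \<phi> x) = 0"
  shows "AE x in lebesgue. x \<in> {a<..<b} \<longrightarrow> u x = 0"
proof (rule AE_eq_0_on_interval)
  fix c d assume cd: "a < c" "c < d" "d < b"
  then have "set_integrable lebesgue {c..d} u"
    using u by (auto simp: locally_integrable_on_def subset_iff)
  then have ucd: "set_integrable lebesgue {c<..<d} u"
    by (rule set_integrable_subset) auto
  have "(LINT x:{c'<..<d'}|lebesgue. indicator {c<..<d} x *\<^sub>R u x) = 0" for c' d'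
  proof -
    \<comment> \<open>These are the endpoints of the intersection of \<open>{c<..<d}\<close> and
      \<open>{c'<..<d'}\<close>, which is empty unless \<open>p < q\<close>.\<close>
    define p q where "p = max c c'" and "q = min d d'"
    have eq: "(LINT x:{c'<..<d'}|lebesgue. indicator {c<..<d} x *\<^sub>R u x)
        = (LINT x|lebesgue. indicator {p<..<q} x *\<^sub>R u x)"
      unfolding set_lebesgue_integral_def p_def q_def
      by (intro Bochner_Integration.integral_cong) (auto simp: indicator_def)
    show ?thesis
    proof (cases "p < q")
      case True
      have pq: "{p..q} \<subseteq> {a<..<b}" "{p<..<q} \<subseteq> {c<..<d}"
        using cd True by (auto simp: p_def q_def)
      have meas: "(\<lambda>x. indicator {a<..<b} x * (u x * bump p q n x)) \<in> borel_measurable lebesgue" for n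
      proof -
        have "set_integrable lebesgue {a<..<b} (\<lambda>x. u x * bump p q n x)"
          by (rule set_integrable_mult_compact_support[OF u, of "{p..q}"])
             (use pq True in \<open>auto intro!: bump_eq_0 C_k_all_continuous C_k_bump\<close>)
        then show ?thesis by (auto simp: set_integrable_def)
      qed
      have "(\<lambda>n. LINT x|lebesgue. indicator {a<..<b} x *\<^sub>R (u x * bump p q n x))
          \<longlonglongrightarrow> (LINT x|lebesgue. indicator {p<..<q} x *\<^sub>R u x)"
      \<comment> \<open>The majorant works because each bump is at most 1 and lives on
        \<open>{p<..<q}\<close>, inside the interval \<open>{c<..<d}\<close> where \<open>u\<close>
        is integrable.\<close>
      proof (rule integral_dominated_convergence[where w = "\<lambda>x. \<bar>indicator {c<..<d} x *\<^sub>R u x\<bar>"])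
        show "AE x in lebesgue. (\<lambda>n. indicator {a<..<b} x *\<^sub>R (u x * bump p q n x))
            \<longlonglongrightarrow> indicator {p<..<q} x *\<^sub>R u x"
        proof (rule AE_I2)
          fix x
          have "(\<lambda>n. indicator {a<..<b} x *\<^sub>R (u x * bump p q n x))
            \<longlonglongrightarrow> indicator {a<..<b} x *\<^sub>R (u x * indicator {p<..<q} x)"
            by (intro tendsto_intros bump_tendsto_indicator True)
          also have "indicator {a<..<b} x *\<^sub>R (u x * indicator {p<..<q} x) = indicator {p<..<q} x *\<^sub>R u x"
            using cd by (auto simp: indicator_def p_def q_def)
          finally show "(\<lambda>n. indicator {a<..<b} x *\<^sub>R (u x * bump p q n x))
            \<longlonglongrightarrow> indicator {p<..<q} x *\<^sub>R u x" .
        qed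
        show "AE x in lebesgue. norm (indicator {a<..<b} x *\<^sub>R (u x * bump p q n x))
            \<le> \<bar>indicator {c<..<d} x *\<^sub>R u x\<bar>" for n
        proof (rule AE_I2)
          fix x
          show "norm (indicator {a<..<b} x *\<^sub>R (u x * bump p q n x))
            \<le> \<bar>indicator {c<..<d} x *\<^sub>R u x\<bar>"
          proof (cases "x \<in> {p<..<q}")
            case x: True
            then have "x \<in> {a<..<b}" "x \<in> {c<..<d}" using cd by (auto simp: p_def q_def)
            then show ?thesis
              using abs_bump_le_1[of p q n x] by (simp add: abs_mult mult_left_le)
          qed (use True in \<open>simp add: bump_eq_0\<close>)
        qed
        show "(\<lambda>x. indicator {p<..<q} x *\<^sub>R u x) \<in> borel_measurable lebesgue"
          using set_integrable_subset[OF ucd _ pq(2)]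
          by (auto simp: set_integrable_def)
        show "integrable lebesgue (\<lambda>x. \<bar>indicator {c<..<d} x *\<^sub>R u x\<bar>)"
          using ucd by (auto simp: set_integrable_def)
      qed (use meas in simp)
      moreover have "(LINT x|lebesgue. indicator {a<..<b} x *\<^sub>R (u x * bump p q n x)) = 0" for n
        using 0[OF test_function_bump[OF True pq(1)]] by (simp add: set_lebesgue_integral_def)
      ultimately show ?thesis
        using LIMSEQ_unique[OF _ tendsto_const] eq by force
    qed (unfold eq, simp)
  qed
  then have "AE x in lebesgue. indicator {c<..<d} x *\<^sub>R u x = 0"
    using ucd by (intro AE_eq_0_if_interval_integrals_eq_0) (auto simp: set_integrable_def)
  then show "AE x in lebesgue. x \<in> {c<..<d} \<longrightarrow> u x = 0"
    by eventually_elim auto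
qed

section \<open>Weak and classical derivatives on an interval\<close>

lemma test_function_continuous: "test_function \<Omega> \<phi> \<Longrightarrow> continuous_on A \<phi>"
  by (simp add: C_k_all_continuous test_function_def)

lemma test_function_has_deriv:
  "test_function \<Omega> \<phi> \<Longrightarrow> (\<phi> has_real_derivative deriv \<phi> x) (at x)"
  by (simp add: C_k_all_has_deriv test_function_def)

text \<open>The complement of the compact set \<open>S\<close> is open, so the function vanishes
  near each of its points, and the same \<open>S\<close> serves for the derivative.\<close>

lemma test_function_deriv:
  assumes "test_function \<Omega> \<phi>"
  shows "test_function \<Omega> (deriv \<phi>)"
proof -
  obtain S where S: "compact S" "S \<subseteq> \<Omega>" "\<And>x. x \<notin> S \<Longrightarrow> \<phi> x = 0"
    using assms by (auto simp: test_function_def)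
  have "deriv \<phi> x = 0" if "x \<notin> S" for x
  proof (rule DERIV_imp_deriv, rule has_field_derivative_transform_within_open)
    show "((\<lambda>x. 0) has_real_derivative 0) (at x)" by simp
    show "open (- S)" using S(1) compact_imp_closed by blast
  qed (use S that in auto)
  then show ?thesis
    using assms S unfolding test_function_def by (blast intro: C_k_deriv)
qed

lemma set_integrable_mult_test_function:
  fixes f \<phi> :: "real \<Rightarrow> real"
  assumes "locally_integrable_on f \<Omega>" "test_function \<Omega> \<phi>"
  shows "set_integrable lebesgue \<Omega> (\<lambda>x. f x * \<phi> x)"
  using assms set_integrable_mult_compact_support[OF assms(1)] test_function_continuous[OF assms(2)]
  unfolding test_function_def by blast

lemma set_lebesgue_integral_mult_cong_AE:
  fixes f g \<phi> :: "real \<Rightarrow> real"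
  assumes "locally_integrable_on f \<Omega>" "locally_integrable_on g \<Omega>" "test_function \<Omega> \<phi>"
    and "AE x in lebesgue. x \<in> \<Omega> \<longrightarrow> f x = g x"
  shows "(LINT x:\<Omega>|lebesgue. f x * \<phi> x) = (LINT x:\<Omega>|lebesgue. g x * \<phi> x)"
  unfolding set_lebesgue_integral_def
proof (rule integral_cong_AE)
  show "AE x in lebesgue. indicator \<Omega> x *\<^sub>R (f x * \<phi> x) = indicator \<Omega> x *\<^sub>R (g x * \<phi> x)"
    using assms(4) by eventually_elim (auto simp: indicator_def)
qed (use assms set_integrable_mult_test_function in \<open>auto simp: set_integrable_def\<close>)

lemma locally_integrable_on_continuous:
  assumes "continuous_on \<Omega> f"
  shows "locally_integrable_on f \<Omega>"
  unfolding locally_integrable_on_def set_integrable_def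
proof (intro allI impI)
  fix S assume "compact S \<and> S \<subseteq> \<Omega>"
  then have "integrable lborel (\<lambda>x. indicator S x *\<^sub>R f x)"
    using assms by (intro borel_integrable_compact) (auto intro: continuous_on_subset)
  then show "integrable lebesgue (\<lambda>x. indicator S x *\<^sub>R f x)"
    by (simp add: integrable_completion)
qed

lemma locally_integrable_on_diff:
  "locally_integrable_on f \<Omega> \<Longrightarrow> locally_integrable_on g \<Omega> \<Longrightarrow> locally_integrable_on (\<lambda>x. f x - g x) \<Omega>"
  by (auto simp: locally_integrable_on_def intro!: set_integral_diff(1))

lemma compact_subset_open_interval:
  fixes S :: "real set"
  assumes "compact S" "S \<subseteq> {a<..<b}" "a < b"
  obtains c d where "a < c" "c < d" "d < b" "S \<subseteq> {c<..<d}"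
proof (cases "S = {}")
  case True
  obtain c where "a < c" "c < b" using dense[OF \<open>a < b\<close>] by blast
  moreover obtain d where "c < d" "d < b" using dense[OF \<open>c < b\<close>] by blast
  ultimately show ?thesis using True that by blast
next
  case False
  obtain s t where s: "s \<in> S" "\<And>x. x \<in> S \<Longrightarrow> s \<le> x" and t: "t \<in> S" "\<And>x. x \<in> S \<Longrightarrow> x \<le> t"
    using compact_attains_inf[OF assms(1) False] compact_attains_sup[OF assms(1) False] by blast
  obtain c where c: "a < c" "c < s" using dense[of a s] s(1) assms(2) by (meson greaterThanLessThan_iff subsetD)
  obtain d where d: "t < d" "d < b" using dense[of t b] t(1) assms(2) by (meson greaterThanLessThan_iff subsetD)
  have "s \<le> t" using s t by blast
  show ?thesis
  proof (rule that)
    show "S \<subseteq> {c<..<d}" using c d s t by fastforce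
  qed (use c d \<open>s \<le> t\<close> in auto)
qed

text \<open>As \<open>f\<close> vanishes off \<open>{c..d}\<close>, only the fundamental theorem on
  this compact interval is involved, and the behaviour of \<open>F\<close> near \<open>a\<close> and
  \<open>b\<close> does not matter.\<close>

lemma LINT_eq_antiderivative:
  fixes f F :: "real \<Rightarrow> real"
  assumes cd: "a < c" "c < d" "d < b"
    and 0: "\<And>x. x \<in> {a<..<b} - {c..d} \<Longrightarrow> f x = 0"
    and F: "\<And>x. x \<in> {c..d} \<Longrightarrow> (F has_real_derivative f x) (at x)"
    and cont: "continuous_on {c..d} f"
  shows "(LINT x:{a<..<b}|lebesgue. f x) = F d - F c"
proof -
  have "has_bochner_integral lborel (\<lambda>x. indicator {c..d} x *\<^sub>R f x) (F d - F c)"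
    using assms by (intro has_bochner_integral_FTC_Icc)
      (auto simp: has_real_derivative_iff_has_vector_derivative[symmetric] intro: DERIV_subset)
  then have "(LINT x|lebesgue. indicator {c..d} x *\<^sub>R f x) = F d - F c"
    by (subst integral_completion) (auto simp: has_bochner_integral_iff)
  moreover have "indicator {a<..<b} x *\<^sub>R f x = indicator {c..d} x *\<^sub>R f x" for x
    using 0[of x] cd by (auto simp: indicator_def)
  ultimately show ?thesis by (simp only: set_lebesgue_integral_def)
qed

text \<open>Integration by parts: \<open>f * \<phi>\<close> is an antiderivative of the sum of both
  integrands, and the compact support of \<open>\<phi>\<close> removes the boundary terms.\<close>

lemma has_weak_deriv_on_classical:
  fixes f g :: "real \<Rightarrow> real"
  assumes "a < b"
    and f: "\<And>x. x \<in> {a<..<b} \<Longrightarrow> (f has_real_derivative g x) (at x)"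
    and g: "continuous_on {a<..<b} g"
  shows "has_weak_deriv_on f g {a<..<b}"
  unfolding has_weak_deriv_on_def
proof (intro conjI allI impI)
  have fc: "continuous_on {a<..<b} f"
    using f by (meson DERIV_continuous_on has_field_derivative_at_within)
  show lf: "locally_integrable_on f {a<..<b}" and lg: "locally_integrable_on g {a<..<b}"
    using fc g by (auto intro: locally_integrable_on_continuous)
  fix \<phi> assume \<phi>: "test_function {a<..<b} \<phi>"
  then obtain S where "compact S" "S \<subseteq> {a<..<b}" and S: "\<And>x. x \<notin> S \<Longrightarrow> \<phi> x = 0"
    unfolding test_function_def by blast
  with compact_subset_open_interval[OF _ _ \<open>a < b\<close>] obtain c d
    where cd: "a < c" "c < d" "d < b" "S \<subseteq> {c<..<d}" by metis
  have \<phi>0: "\<phi> x = 0" if "x \<notin> {c<..<d}" for x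
    using that cd S by blast
  have \<phi>'0: "deriv \<phi> x = 0" if "x \<notin> {c..d}" for x
  proof (rule DERIV_imp_deriv, rule has_field_derivative_transform_within_open)
    show "((\<lambda>x. 0) has_real_derivative 0) (at x)" by simp
    show "open (- {c..d})" by auto
  qed (use \<phi>0 that in auto)
  have sub: "{c..d} \<subseteq> {a<..<b}" using cd by auto
  have "(LINT x:{a<..<b}|lebesgue. f x * deriv \<phi> x + g x * \<phi> x) = f d * \<phi> d - f c * \<phi> c"
  proof (rule LINT_eq_antiderivative[OF cd(1-3)])
    show "((\<lambda>x. f x * \<phi> x) has_real_derivative f x * deriv \<phi> x + g x * \<phi> x) (at x)"
      if "x \<in> {c..d}" for x
      using that sub by (auto intro!: derivative_eq_intros f test_function_has_deriv[OF \<phi>])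
    show "continuous_on {c..d} (\<lambda>x. f x * deriv \<phi> x + g x * \<phi> x)"
      using continuous_on_subset[OF fc sub] continuous_on_subset[OF g sub]
        test_function_continuous[OF \<phi>] test_function_continuous[OF test_function_deriv[OF \<phi>]]
      by (intro continuous_intros)
  qed (use \<phi>0 \<phi>'0 in auto)
  also have "\<dots> = 0" using \<phi>0 by simp
  finally show "(LINT x:{a<..<b}|lebesgue. f x * deriv \<phi> x) = - (LINT x:{a<..<b}|lebesgue. g x * \<phi> x)"
    using set_integrable_mult_test_function[OF lf test_function_deriv[OF \<phi>]]
      set_integrable_mult_test_function[OF lg \<phi>]
    by (simp add: set_integral_add(2))
qed

section \<open>Antiderivatives and the du Bois-Reymond lemma\<close>

lemma continuous_antiderivative_on:
  fixes f :: "real \<Rightarrow> real"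
  assumes "continuous_on {a<..<b} f" "a < b"
  obtains F where "\<And>x. x \<in> {a<..<b} \<Longrightarrow> (F has_real_derivative f x) (at x)"
proof -
  have "\<exists>F. \<forall>x. ereal a < ereal x \<longrightarrow> ereal x < ereal b \<longrightarrow> (F has_vector_derivative f x) (at x)"
    using assms by (intro einterval_antiderivative)
      (auto simp: continuous_on_eq_continuous_at)
  then show ?thesis
    using that by (auto simp: has_real_derivative_iff_has_vector_derivative)
qed

text \<open>Any antiderivative is constant on each side of the support of \<open>\<phi>\<close>. The
  vanishing integral makes the two constants equal, so subtracting one of them leaves compact
  support.\<close>

lemma test_function_antiderivative:
  assumes "a < b" and \<phi>: "test_function {a<..<b} \<phi>" and 0: "(LINT x:{a<..<b}|lebesgue. \<phi> x) = 0"
  obtains \<psi> where "test_function {a<..<b} \<psi>" "deriv \<psi> = \<phi>"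
proof -
  have "\<exists>F. \<forall>x. (-\<infinity>::ereal) < ereal x \<longrightarrow> ereal x < \<infinity> \<longrightarrow> (F has_vector_derivative \<phi> x) (at x)"
    using test_function_continuous[OF \<phi>, of UNIV]
    by (intro einterval_antiderivative) (auto simp: continuous_on_eq_continuous_at)
  then obtain F where F: "\<And>x. (F has_real_derivative \<phi> x) (at x)"
    by (auto simp: has_real_derivative_iff_has_vector_derivative)
  obtain S where "compact S" "S \<subseteq> {a<..<b}" and S: "\<And>x. x \<notin> S \<Longrightarrow> \<phi> x = 0"
    using \<phi> unfolding test_function_def by blast
  with compact_subset_open_interval[OF _ _ \<open>a < b\<close>] obtain c d
    where cd: "a < c" "c < d" "d < b" "S \<subseteq> {c<..<d}" by metis
  have \<phi>0: "\<phi> x = 0" if "x \<notin> {c<..<d}" for x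
    using that cd S by blast
  have "F d = F c"
    using LINT_eq_antiderivative[OF cd(1-3), of \<phi> F] F \<phi>0 0 test_function_continuous[OF \<phi>] by fastforce
  have Fc: "continuous_on A F" for A
    using F by (meson DERIV_continuous_on has_field_derivative_at_within)
  have F0: "(F has_real_derivative 0) (at x)" if "x \<notin> {c<..<d}" for x
    using F[of x] \<phi>0[OF that] by simp
  have left: "F x = F c" if "x < c" for x
    using DERIV_isconst_end[OF that Fc] F0 that by simp
  have right: "F x = F d" if "d < x" for x
    using DERIV_isconst_end[OF that Fc] F0 that by simp
  show ?thesis
  proof (rule that[of "\<lambda>x. F x - F c"])
    have D: "((\<lambda>x. F x - F c) has_real_derivative \<phi> x) (at x)" for x
      using F by (auto intro!: derivative_eq_intros)
    then show "deriv (\<lambda>x. F x - F c) = \<phi>"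
      by (intro ext DERIV_imp_deriv)
    have "C_k k (\<lambda>x. F x - F c)" for k
      using \<phi> by (intro C_k_all_antideriv[OF _ D]) (simp add: test_function_def)
    moreover have "F x - F c = 0" if "x \<notin> {c..d}" for x
    proof -
      have "x < c \<or> d < x" using that by auto
      then show ?thesis using left right \<open>F d = F c\<close> by auto
    qed
    moreover have "{c..d} \<subseteq> {a<..<b}" using cd by auto
    ultimately show "test_function {a<..<b} (\<lambda>x. F x - F c)"
      unfolding test_function_def using compact_Icc by blast
  qed
qed

lemma test_function_diff_scaled:
  assumes f: "test_function \<Omega> f" and g: "test_function \<Omega> g"
  shows "test_function \<Omega> (\<lambda>x. f x - c * g x)"
proof -
  obtain S T where "compact S" "S \<subseteq> \<Omega>" "\<forall>x. x \<notin> S \<longrightarrow> f x = 0"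
      "compact T" "T \<subseteq> \<Omega>" "\<forall>x. x \<notin> T \<longrightarrow> g x = 0"
    using f g unfolding test_function_def by blast
  then show ?thesis
    using assms unfolding test_function_def
    by (auto intro!: exI[of _ "S \<union> T"] C_k_all_diff_scaled)
qed

text \<open>The hypothesis concerns derivatives of test functions only. Subtracting from
  \<open>\<phi>\<close> the multiple of a fixed \<open>\<rho>\<close> with the same integral gives
  such a derivative, which shows that \<open>f\<close> acts on \<open>\<phi>\<close> as a constant
  does.\<close>

lemma weak_deriv_zero_imp_const:
  fixes f :: "real \<Rightarrow> real"
  assumes "a < b" and f: "locally_integrable_on f {a<..<b}"
    and 0: "\<And>\<phi>. test_function {a<..<b} \<phi> \<Longrightarrow> (LINT x:{a<..<b}|lebesgue. f x * deriv \<phi> x) = 0"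
  obtains C where "AE x in lebesgue. x \<in> {a<..<b} \<longrightarrow> f x = C"
proof -
  obtain c d where cd: "a < c" "c < d" "d < b"
    using compact_subset_open_interval[OF compact_empty empty_subsetI \<open>a < b\<close>] by metis
  define \<rho> where "\<rho> = bump c d 0"
  have \<rho>: "test_function {a<..<b} \<rho>"
    unfolding \<rho>_def using cd by (intro test_function_bump) auto
  define I where "I = (LINT x:{a<..<b}|lebesgue. \<rho> x)"
  \<comment> \<open>Positivity is read off an antiderivative, which increases strictly where the
    bump is positive.\<close>
  have "I > 0"
  proof -
    obtain F where F: "\<And>x. x \<in> {a<..<b} \<Longrightarrow> (F has_real_derivative \<rho> x) (at x)"
      using continuous_antiderivative_on[OF test_function_continuous[OF \<rho>] \<open>a < b\<close>] by blast
    have "I = F d - F c" unfolding I_def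
      by (rule LINT_eq_antiderivative[OF cd])
        (use F cd test_function_continuous[OF \<rho>] in \<open>auto simp: \<rho>_def intro: bump_eq_0\<close>)
    moreover have "F c < F d"
    proof (rule DERIV_pos_imp_increasing_open[OF \<open>c < d\<close>])
      show "\<exists>y. (F has_real_derivative y) (at x) \<and> 0 < y" if "c < x" "x < d" for x
        using F[of x] that cd bump_pos[of x c d 0] unfolding \<rho>_def by (intro exI[of _ "bump c d 0 x"]) auto
      show "continuous_on {c..d} F"
        by (rule DERIV_continuous_on[where D = \<rho>]) (use F cd in \<open>auto intro: has_field_derivative_at_within\<close>)
    qed
    ultimately show ?thesis by simp
  qed
  \<comment> \<open>A constant \<open>f\<close> must equal its weighted mean against
    \<open>\<rho>\<close>, so this is the only candidate.\<close>
  define C where "C = (LINT x:{a<..<b}|lebesgue. f x * \<rho> x) / I"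
  have one: "locally_integrable_on (\<lambda>x. 1) {a<..<b}" and lC: "locally_integrable_on (\<lambda>x. C) {a<..<b}"
    by (intro locally_integrable_on_continuous continuous_intros)+
  have "AE x in lebesgue. x \<in> {a<..<b} \<longrightarrow> f x - C = 0"
  proof (rule fundamental_lemma_calculus_of_variations)
    show "locally_integrable_on (\<lambda>x. f x - C) {a<..<b}"
      by (rule locally_integrable_on_diff[OF f lC])
    fix \<phi> assume \<phi>: "test_function {a<..<b} \<phi>"
    define J where "J = (LINT x:{a<..<b}|lebesgue. \<phi> x)"
    have i\<phi>: "set_integrable lebesgue {a<..<b} \<phi>" and i\<rho>: "set_integrable lebesgue {a<..<b} \<rho>"
      using set_integrable_mult_test_function[OF one \<phi>] set_integrable_mult_test_function[OF one \<rho>]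
      by simp_all
    have i\<rho>J: "set_integrable lebesgue {a<..<b} (\<lambda>x. (J / I) * \<rho> x)"
      using i\<rho> by (intro set_integrable_mult_right)
    have "(LINT x:{a<..<b}|lebesgue. \<phi> x - (J / I) * \<rho> x) = J - (J / I) * I"
      using set_integral_diff(2)[OF i\<phi> i\<rho>J] by (simp add: J_def I_def)
    then have "(LINT x:{a<..<b}|lebesgue. \<phi> x - (J / I) * \<rho> x) = 0" using \<open>I > 0\<close> by simp
    from test_function_antiderivative[OF \<open>a < b\<close> test_function_diff_scaled[OF \<phi> \<rho>] this]
    obtain \<psi> where "test_function {a<..<b} \<psi>" "deriv \<psi> = (\<lambda>x. \<phi> x - (J / I) * \<rho> x)" .
    from 0[OF this(1)] this(2)
    have "0 = (LINT x:{a<..<b}|lebesgue. f x * \<phi> x - (J / I) * (f x * \<rho> x))"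
      by (simp add: algebra_simps)
    also have "\<dots> = (LINT x:{a<..<b}|lebesgue. f x * \<phi> x) - (J / I) * (LINT x:{a<..<b}|lebesgue. f x * \<rho> x)"
      using set_integrable_mult_test_function[OF f \<phi>] set_integrable_mult_test_function[OF f \<rho>]
      by (subst set_integral_diff(2)) (auto intro: set_integrable_mult_right)
    finally have "(LINT x:{a<..<b}|lebesgue. f x * \<phi> x) = C * J"
      by (simp add: C_def mult.commute)
    moreover have "(LINT x:{a<..<b}|lebesgue. (f x - C) * \<phi> x) = (LINT x:{a<..<b}|lebesgue. f x * \<phi> x) - C * J"
      unfolding J_def left_diff_distrib
      using set_integrable_mult_test_function[OF f \<phi>] set_integrable_mult_test_function[OF lC \<phi>]
      by (subst set_integral_diff(2)) auto
    ultimately show "(LINT x:{a<..<b}|lebesgue. (f x - C) * \<phi> x) = 0" by simp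
  qed
  then show ?thesis by (intro that[of C]) simp
qed

text \<open>The agreement set \<open>T\<close> is relatively closed in \<open>S\<close> and has full
  measure there; every point of the open set \<open>S\<close> lies in the closure of
  \<open>T\<close>, hence in \<open>T\<close>.\<close>

lemma continuous_AE_eq_imp_eq:
  fixes f g :: "real \<Rightarrow> real"
  assumes "open S" "continuous_on S f" "continuous_on S g"
    and AE: "AE x in lebesgue. x \<in> S \<longrightarrow> f x = g x" and "x \<in> S"
  shows "f x = g x"
proof -
  define T where "T = {x \<in> S. f x - g x = 0}"
  have "closedin (top_of_set S) T"
    unfolding T_def
    by (rule continuous_closedin_preimage_constant[OF continuous_on_diff[OF assms(2,3)]])
  then have T: "T = S \<inter> closure T" unfolding closedin_limpt closure_def by blast
  have "AE x\<in>S in lebesgue. x \<in> closure T"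
    using AE
  proof eventually_elim
    case (elim x)
    then have "x \<in> S \<longrightarrow> x \<in> T" by (simp add: T_def)
    then show ?case using closure_subset by blast
  qed
  then have "x \<in> closure T"
    using mem_closed_if_AE_lebesgue_open assms(1,5) closed_closure by blast
  then have "x \<in> T" using \<open>x \<in> S\<close> by (subst T) blast
  then show ?thesis by (simp add: T_def)
qed

text \<open>With \<open>H\<close> a classical antiderivative of \<open>G\<close>, the difference
  \<open>f - H\<close> has weak derivative 0 and is constant almost everywhere; continuity upgrades
  this to \<open>F = H + C\<close> at every point. Keeping \<open>f\<close>, \<open>g\<close> apart
  from \<open>F\<close>, \<open>G\<close> suits the fluxes, whose given forms are only almost
  everywhere equal to continuous functions.\<close>

lemma weak_deriv_continuous_imp_deriv:
  fixes f g F G :: "real \<Rightarrow> real"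
  assumes "a < b" and weak: "has_weak_deriv_on f g {a<..<b}"
    and F: "AE x in lebesgue. x \<in> {a<..<b} \<longrightarrow> f x = F x" "continuous_on {a<..<b} F"
    and G: "AE x in lebesgue. x \<in> {a<..<b} \<longrightarrow> g x = G x" "continuous_on {a<..<b} G"
    and x: "x \<in> {a<..<b}"
  shows "(F has_real_derivative G x) (at x)"
proof -
  have lf: "locally_integrable_on f {a<..<b}" and lg: "locally_integrable_on g {a<..<b}"
    using weak by (auto simp: has_weak_deriv_on_def)
  obtain H where H: "\<And>x. x \<in> {a<..<b} \<Longrightarrow> (H has_real_derivative G x) (at x)"
    using continuous_antiderivative_on[OF G(2) \<open>a < b\<close>] by blast
  have wH: "has_weak_deriv_on H G {a<..<b}"
    using H G(2) by (intro has_weak_deriv_on_classical \<open>a < b\<close>)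
  then have lH: "locally_integrable_on H {a<..<b}" and lG: "locally_integrable_on G {a<..<b}"
    by (auto simp: has_weak_deriv_on_def)
  have "(LINT x:{a<..<b}|lebesgue. (f x - H x) * deriv \<phi> x) = 0" if \<phi>: "test_function {a<..<b} \<phi>" for \<phi>
  proof -
    have "(LINT x:{a<..<b}|lebesgue. (f x - H x) * deriv \<phi> x)
      = (LINT x:{a<..<b}|lebesgue. f x * deriv \<phi> x) - (LINT x:{a<..<b}|lebesgue. H x * deriv \<phi> x)"
      unfolding left_diff_distrib using \<phi> lf lH
      by (intro set_integral_diff(2) set_integrable_mult_test_function test_function_deriv)
    also have "\<dots> = (LINT x:{a<..<b}|lebesgue. G x * \<phi> x) - (LINT x:{a<..<b}|lebesgue. g x * \<phi> x)"
      using weak wH \<phi> by (simp add: has_weak_deriv_on_def)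
    also have "\<dots> = 0"
      using set_lebesgue_integral_mult_cong_AE[OF lg lG \<phi> G(1)] by simp
    finally show ?thesis .
  qed
  from weak_deriv_zero_imp_const[OF \<open>a < b\<close> locally_integrable_on_diff[OF lf lH] this]
  obtain C where C: "AE x in lebesgue. x \<in> {a<..<b} \<longrightarrow> f x - H x = C" by blast
  have cH: "continuous_on {a<..<b} H"
    using H by (meson DERIV_continuous_on has_field_derivative_at_within)
  have eq: "H y + C = F y" if "y \<in> {a<..<b}" for y
  proof (rule continuous_AE_eq_imp_eq[OF _ _ F(2) _ that])
    show "AE x in lebesgue. x \<in> {a<..<b} \<longrightarrow> H x + C = F x"
      using C F(1) by eventually_elim auto
  qed (auto intro!: continuous_intros cH)
  have "((\<lambda>x. H x + C) has_real_derivative G x) (at x)"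
    using H[OF x] by (auto intro!: derivative_eq_intros)
  then show ?thesis
    by (rule has_field_derivative_transform_within_open[where S = "{a<..<b}"]) (use x eq in auto)
qed

text \<open>Both \<open>g\<close> and \<open>G\<close> are weak derivatives of \<open>f\<close>, so
  their difference integrates to 0 against every test function.\<close>

lemma weak_deriv_eq_deriv_AE:
  fixes f g G :: "real \<Rightarrow> real"
  assumes "a < b" and weak: "has_weak_deriv_on f g {a<..<b}"
    and f: "\<And>x. x \<in> {a<..<b} \<Longrightarrow> (f has_real_derivative G x) (at x)"
    and G: "continuous_on {a<..<b} G"
  shows "AE x in lebesgue. x \<in> {a<..<b} \<longrightarrow> g x = G x"
proof -
  have wG: "has_weak_deriv_on f G {a<..<b}"
    using f G by (intro has_weak_deriv_on_classical \<open>a < b\<close>)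
  have lg: "locally_integrable_on g {a<..<b}" and lG: "locally_integrable_on G {a<..<b}"
    using weak wG by (auto simp: has_weak_deriv_on_def)
  have "AE x in lebesgue. x \<in> {a<..<b} \<longrightarrow> g x - G x = 0"
  proof (rule fundamental_lemma_calculus_of_variations[OF locally_integrable_on_diff[OF lg lG]])
    fix \<phi> assume \<phi>: "test_function {a<..<b} \<phi>"
    have "(LINT x:{a<..<b}|lebesgue. (g x - G x) * \<phi> x)
      = (LINT x:{a<..<b}|lebesgue. g x * \<phi> x) - (LINT x:{a<..<b}|lebesgue. G x * \<phi> x)"
      unfolding left_diff_distrib using \<phi> lg lG
      by (intro set_integral_diff(2) set_integrable_mult_test_function)
    also have "(LINT x:{a<..<b}|lebesgue. g x * \<phi> x) = - (LINT x:{a<..<b}|lebesgue. f x * deriv \<phi> x)"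
      using weak \<phi> by (simp add: has_weak_deriv_on_def)
    also have "(LINT x:{a<..<b}|lebesgue. G x * \<phi> x) = - (LINT x:{a<..<b}|lebesgue. f x * deriv \<phi> x)"
      using wG \<phi> by (simp add: has_weak_deriv_on_def)
    finally show "(LINT x:{a<..<b}|lebesgue. (g x - G x) * \<phi> x) = 0" by simp
  qed
  then show ?thesis by simp
qed

section \<open>Constants as Sobolev functions\<close>

lemma AE_lebesgue_on_interval_iff:
  "(AE x in lebesgue_on {a<..<b::real}. P x) \<longleftrightarrow> (AE x in lebesgue. x \<in> {a<..<b} \<longrightarrow> P x)"
  by (subst AE_restrict_space_iff) auto

lemma has_weak_deriv_on_const:
  fixes f :: "real \<Rightarrow> real"
  assumes "a < b" "\<And>x. x \<in> {a<..<b} \<Longrightarrow> f x = c"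
  shows "has_weak_deriv_on f (\<lambda>x. 0) {a<..<b}"
proof (rule has_weak_deriv_on_classical[OF \<open>a < b\<close>])
  show "(f has_real_derivative 0) (at x)" if "x \<in> {a<..<b}" for x
  proof (rule has_field_derivative_transform_within_open)
    show "((\<lambda>x. c) has_real_derivative 0) (at x)" by simp
    show "open {a<..<b}" by simp
  qed (use that assms in auto)
qed simp

lemma const_in_L2_space:
  fixes f :: "real \<Rightarrow> real"
  assumes "\<And>x. x \<in> {a<..<b} \<Longrightarrow> f x = c"
  shows "f \<in> L2_space {a<..<b}"
proof -
  have "integrable lebesgue (indicat_real {a<..<b})"
    by (rule integrable_real_indicator) (use emeasure_lborel_box_finite[of a b] in auto)
  then have "integrable (lebesgue_on {a<..<b}) (\<lambda>x. c\<^sup>2)"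
    by (subst integrable_restrict_space) auto
  moreover have "integrable (lebesgue_on {a<..<b}) (\<lambda>x. (f x)\<^sup>2) \<longleftrightarrow> integrable (lebesgue_on {a<..<b}) (\<lambda>x. c\<^sup>2)"
    using assms by (intro Bochner_Integration.integrable_cong) auto
  moreover have "f \<in> borel_measurable (lebesgue_on {a<..<b}) \<longleftrightarrow> (\<lambda>x. c) \<in> borel_measurable (lebesgue_on {a<..<b})"
    using assms by (intro measurable_cong) auto
  ultimately show ?thesis by (simp add: L2_space_def)
qed

lemma const_in_sobolev_H:
  assumes "a < b" "\<And>x. x \<in> {a<..<b} \<Longrightarrow> f x = c"
  shows "f \<in> sobolev_H k {a<..<b}"
  using assms(2)
proof (induction k arbitrary: f c)
  case 0
  then show ?case using const_in_L2_space by simp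
next
  case (Suc k)
  have "(\<lambda>x. 0) \<in> sobolev_H k {a<..<b}" by (rule Suc.IH) simp
  then show ?case
    using const_in_L2_space[of a b f c] has_weak_deriv_on_const[of a b f c] \<open>a < b\<close> Suc.prems by auto
qed

section \<open>Steady states\<close>

lemma deriv_0_imp_const_on_Icc:
  fixes f :: "real \<Rightarrow> real"
  assumes "a < b" "continuous_on {a..b} f"
    and "\<And>x. x \<in> {a<..<b} \<Longrightarrow> (f has_real_derivative 0) (at x)"
    and "x \<in> {a..b}"
  shows "f x = f a"
  by (rule DERIV_isconst2[OF assms(1,2)]) (use assms(3,4) in auto)

text \<open>The product \<open>F * w\<close> has a nonnegative derivative and vanishes at both ends
  because \<open>F\<close> does; no boundary value of \<open>w\<close> enters.\<close>

lemma flux_system_trivial: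
  fixes F w b :: "real \<Rightarrow> real"
  assumes "p < q" "K > 0"
    and cont: "continuous_on {p..q} F" "continuous_on {p..q} w"
    and F: "\<And>x. x \<in> {p<..<q} \<Longrightarrow> (F has_real_derivative K * w x) (at x)"
    and w: "\<And>x. x \<in> {p<..<q} \<Longrightarrow> (w has_real_derivative b x * F x) (at x)"
    and b: "\<And>x. x \<in> {p<..<q} \<Longrightarrow> b x \<ge> 0"
    and bdry: "F p = 0" "F q = 0"
    and x: "x \<in> {p<..<q}"
  shows "F x = 0" "w x = 0"
proof -
  define P where "P x = F x * w x" for x
  define P' where "P' x = K * (w x)\<^sup>2 + b x * (F x)\<^sup>2" for x
  have P: "(P has_real_derivative P' y) (at y)" if "y \<in> {p<..<q}" for y
    unfolding P_def P'_def using F[OF that] w[OF that]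
    by (auto intro!: derivative_eq_intros simp: power2_eq_square algebra_simps)
  have P'_nonneg: "P' y \<ge> 0" if "y \<in> {p<..<q}" for y
    using b[OF that] \<open>K > 0\<close> by (simp add: P'_def)
  have cP: "continuous_on {p..q} P"
    unfolding P_def by (intro continuous_intros cont)
  have mono: "P y \<le> P z" if "p \<le> y" "y \<le> z" "z \<le> q" for y z
  proof (rule DERIV_nonneg_imp_increasing_open[OF that(2)])
    show "continuous_on {y..z} P" using continuous_on_subset[OF cP] that by auto
    show "\<exists>d. (P has_real_derivative d) (at u) \<and> 0 \<le> d" if "y < u" "u < z" for u
      using P[of u] P'_nonneg[of u] that \<open>p \<le> y\<close> \<open>z \<le> q\<close> by force
  qed
  \<comment> \<open>A nondecreasing function with value 0 at both ends is squeezed to 0.\<close>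
  have P0: "P y = 0" if "y \<in> {p<..<q}" for y
    using mono[of p y] mono[of y q] that bdry by (simp add: P_def)
  have w0: "w y = 0" if y: "y \<in> {p<..<q}" for y
  proof -
    have "((\<lambda>x. 0) has_real_derivative P' y) (at y)"
      by (rule has_field_derivative_transform_within_open[OF P[OF y], of "{p<..<q}"]) (use P0 y in auto)
    then have "P' y = 0" using DERIV_unique[OF _ DERIV_const] by blast
    moreover have "b y * (F y)\<^sup>2 \<ge> 0" "K * (w y)\<^sup>2 \<ge> 0" using b[OF y] \<open>K > 0\<close> by simp_all
    ultimately have "K * (w y)\<^sup>2 = 0" unfolding P'_def by linarith
    then show ?thesis using \<open>K > 0\<close> by simp
  qed
  show "w x = 0" by (rule w0[OF x])
  \<comment> \<open>Since \<open>b\<close> is only nonnegative, \<open>F\<close> is not read off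
    from \<open>P' = 0\<close>; instead \<open>w = 0\<close> makes the derivative
    \<open>K * w\<close> of \<open>F\<close> vanish.\<close>
  have "F x = F p"
  proof (rule deriv_0_imp_const_on_Icc[OF \<open>p < q\<close> cont(1)])
    show "(F has_real_derivative 0) (at y)" if "y \<in> {p<..<q}" for y
      using F[OF that] w0[OF that] by simp
  qed (use x in auto)
  then show "F x = 0" using bdry by simp
qed

text \<open>All derivatives and fluxes vanish, and the relation between \<open>ms\<close>,
  \<open>hs\<close> and \<open>\<Gamma>s\<close> is exactly what makes the reaction term
  vanish.\<close>

lemma steady_state_const:
  fixes L G D \<delta> \<beta> K :: real and \<sigma> h m \<Gamma> :: "real \<Rightarrow> real"
  assumes "L > 0" "\<beta> > 0" "hs > 0" "ms = hs * \<Gamma>s / \<beta>" "ms > 0"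
    and eq: "\<And>x. x \<in> {0..L} \<Longrightarrow> h x = hs \<and> m x = ms \<and> \<Gamma> x = \<Gamma>s"
  shows "steady_state L G D \<delta> \<beta> K \<sigma> h m \<Gamma>"
proof -
  have "\<Gamma>s > 0" using assms(2-5) by (simp add: zero_less_mult_iff zero_less_divide_iff)
  have react: "\<beta> * ms / hs - \<Gamma>s = 0" using assms by simp
  have cont: "continuous_on {0..L} h \<and> continuous_on {0..L} m \<and> continuous_on {0..L} \<Gamma>"
    using continuous_on_cong[of "{0..L}" "{0..L}" h "\<lambda>_. hs"]
      continuous_on_cong[of "{0..L}" "{0..L}" m "\<lambda>_. ms"]
      continuous_on_cong[of "{0..L}" "{0..L}" \<Gamma> "\<lambda>_. \<Gamma>s"] eq by simp
  have eq': "h x = hs" "m x = ms" "\<Gamma> x = \<Gamma>s" if "x \<in> {0<..<L}" for x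
    using eq[of x] that by auto
  note wd = has_weak_deriv_on_const[OF \<open>L > 0\<close>]
  show ?thesis
    unfolding steady_state_def
  proof (intro conjI exI)
    show "h \<in> sobolev_H 2 {0<..<L}" "m \<in> sobolev_H 2 {0<..<L}" "\<Gamma> \<in> sobolev_H 2 {0<..<L}"
      using const_in_sobolev_H[OF \<open>L > 0\<close>] eq' by blast+
    show "continuous_on {0..L} h" "continuous_on {0..L} m" "continuous_on {0..L} \<Gamma>"
      using cont by auto
    show "\<forall>x\<in>{0..L}. h x > 0 \<and> m x > 0 \<and> \<Gamma> x > 0"
      using eq assms \<open>\<Gamma>s > 0\<close> by simp
    \<comment> \<open>These goals fix the existential witnesses: the zero function for each of the
      seven derivatives.\<close>
    show "has_weak_deriv_on h (\<lambda>x. 0) {0<..<L}" "has_weak_deriv_on m (\<lambda>x. 0) {0<..<L}"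
      "has_weak_deriv_on \<Gamma> (\<lambda>x. 0) {0<..<L}"
      using wd eq' by blast+
    show "has_weak_deriv_on (\<lambda>x. \<sigma> (\<Gamma> x)) (\<lambda>x. 0) {0<..<L}"
      by (rule wd[of _ "\<sigma> \<Gamma>s"]) (simp add: eq')
    show "has_weak_deriv_on (\<lambda>x. G / 3 * h x ^ 3 * 0 - 1 / 2 * h x ^ 2 * 0) (\<lambda>x. 0) {0<..<L}"
      "has_weak_deriv_on (\<lambda>x. G / 3 * h x ^ 2 * m x * 0 - 1 / 2 * h x * m x * 0
               + \<delta> * 0 - \<delta> * (m x / h x) * 0) (\<lambda>x. 0) {0<..<L}"
      "has_weak_deriv_on (\<lambda>x. G / 2 * h x ^ 2 * \<Gamma> x * 0 - h x * \<Gamma> x * 0 + D * 0) (\<lambda>x. 0) {0<..<L}"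
      by (rule wd[of _ 0]; simp)+
    show "AE x in lebesgue_on {0<..<L}. - 0 = - K * (\<beta> * m x / h x - \<Gamma> x)"
      "AE x in lebesgue_on {0<..<L}. - 0 = K * (\<beta> * m x / h x - \<Gamma> x)"
      unfolding AE_lebesgue_on_interval_iff using react by (auto simp: eq')
  qed auto
qed

lemma steady_state_imp_const:
  fixes L G D \<delta> \<beta> K :: real and \<sigma> h m \<Gamma> :: "real \<Rightarrow> real"
  assumes pos: "L > 0" "G > 0" "D > 0" "\<delta> > 0" "\<beta> > 0" "K > 0"
    and \<sigma>: "\<And>x. (\<sigma> has_real_derivative \<sigma>' x) (at x)" "continuous_on UNIV \<sigma>'" "\<And>x. \<sigma>' x \<le> 0"
    and st: "steady_state L G D \<delta> \<beta> K \<sigma> h m \<Gamma>"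
    and x: "x \<in> {0..L}"
  shows "h x = h 0" "m x = h 0 * \<Gamma> 0 / \<beta>" "\<Gamma> x = \<Gamma> 0"
proof -
  obtain hx mx \<Gamma>x sx J1 J2 J3 where
    c: "continuous_on {0..L} h" "continuous_on {0..L} m" "continuous_on {0..L} \<Gamma>" and
    pos': "\<forall>x\<in>{0..L}. h x > 0 \<and> m x > 0 \<and> \<Gamma> x > 0" and
    wh: "has_weak_deriv_on h hx {0<..<L}" "continuous_on {0..L} hx" and
    wm: "has_weak_deriv_on m mx {0<..<L}" "continuous_on {0..L} mx" and
    w\<Gamma>: "has_weak_deriv_on \<Gamma> \<Gamma>x {0<..<L}" "continuous_on {0..L} \<Gamma>x" and
    ws: "has_weak_deriv_on (\<lambda>x. \<sigma> (\<Gamma> x)) sx {0<..<L}" and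
    w1: "has_weak_deriv_on (\<lambda>x. G / 3 * h x ^ 3 * hx x - 1 / 2 * h x ^ 2 * sx x) J1 {0<..<L}" and
    w2: "has_weak_deriv_on
          (\<lambda>x. G / 3 * h x ^ 2 * m x * hx x - 1 / 2 * h x * m x * sx x
               + \<delta> * mx x - \<delta> * (m x / h x) * hx x) J2 {0<..<L}" and
    w3: "has_weak_deriv_on
          (\<lambda>x. G / 2 * h x ^ 2 * \<Gamma> x * hx x - h x * \<Gamma> x * sx x + D * \<Gamma>x x) J3 {0<..<L}" and
    J: "AE x in lebesgue_on {0<..<L}. - J1 x = 0"
      "AE x in lebesgue_on {0<..<L}. - J2 x = - K * (\<beta> * m x / h x - \<Gamma> x)"
      "AE x in lebesgue_on {0<..<L}. - J3 x = K * (\<beta> * m x / h x - \<Gamma> x)" and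
    bdry: "hx 0 = 0" "hx L = 0" "mx 0 = 0" "mx L = 0" "\<Gamma>x 0 = 0" "\<Gamma>x L = 0"
    using st unfolding steady_state_def by (elim conjE exE) (rule that; assumption)
  have p: "h x > 0" "m x > 0" "\<Gamma> x > 0" if "x \<in> {0..L}" for x
    using pos' that by auto
  have sub: "{0<..<L} \<subseteq> {0..L}" by auto
  note co = continuous_on_subset[OF _ sub]
  note strong = weak_deriv_continuous_imp_deriv[OF \<open>L > 0\<close>]
  have dh: "(h has_real_derivative hx x) (at x)" if "x \<in> {0<..<L}" for x
    by (rule strong[OF wh(1)]) (use c wh that in \<open>auto intro: co\<close>)
  have dm: "(m has_real_derivative mx x) (at x)" if "x \<in> {0<..<L}" for x
    by (rule strong[OF wm(1)]) (use c wm that in \<open>auto intro: co\<close>)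
  have d\<Gamma>: "(\<Gamma> has_real_derivative \<Gamma>x x) (at x)" if "x \<in> {0<..<L}" for x
    by (rule strong[OF w\<Gamma>(1)]) (use c w\<Gamma> that in \<open>auto intro: co\<close>)
  define s where "s x = \<sigma>' (\<Gamma> x)" for x
  have cs: "continuous_on {0..L} s"
    unfolding s_def by (rule continuous_on_compose2[OF \<sigma>(2) c(3)]) auto
  have s_nonpos: "s x \<le> 0" for x using \<sigma>(3) by (simp add: s_def)
  \<comment> \<open>The function \<open>sx\<close> is only determined almost everywhere; replacing
    it by the chain rule expression gives the fluxes continuous representatives, defined below as
    \<open>F1\<close>, \<open>F2\<close> and \<open>F3\<close>.\<close>
  have sx: "AE x in lebesgue. x \<in> {0<..<L} \<longrightarrow> sx x = s x * \<Gamma>x x"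
  proof (rule weak_deriv_eq_deriv_AE[OF \<open>L > 0\<close> ws])
    show "((\<lambda>x. \<sigma> (\<Gamma> x)) has_real_derivative s x * \<Gamma>x x) (at x)" if "x \<in> {0<..<L}" for x
      unfolding s_def by (rule DERIV_chain2[OF \<sigma>(1) d\<Gamma>[OF that]])
    show "continuous_on {0<..<L} (\<lambda>x. s x * \<Gamma>x x)"
      by (intro co continuous_intros cs w\<Gamma>)
  qed
  have h0: "h x \<noteq> 0" if "x \<in> {0..L}" for x using p(1)[OF that] by simp
  define w where "w x = \<beta> * m x / h x - \<Gamma> x" for x
  have cw: "continuous_on {0..L} w"
    unfolding w_def by (intro continuous_intros c ballI h0)
  define F1 where "F1 x = G / 3 * h x ^ 3 * hx x - 1 / 2 * h x ^ 2 * (s x * \<Gamma>x x)" for x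
  define F2 where "F2 x = G / 3 * h x ^ 2 * m x * hx x - 1 / 2 * h x * m x * (s x * \<Gamma>x x)
               + \<delta> * mx x - \<delta> * (m x / h x) * hx x" for x
  define F3 where "F3 x = G / 2 * h x ^ 2 * \<Gamma> x * hx x - h x * \<Gamma> x * (s x * \<Gamma>x x) + D * \<Gamma>x x" for x
  have cF: "continuous_on {0..L} F1" "continuous_on {0..L} F2" "continuous_on {0..L} F3"
    unfolding F1_def F2_def F3_def
    by (intro continuous_intros c cs wh wm w\<Gamma> ballI h0; assumption?)+
  note J' = J[unfolded AE_lebesgue_on_interval_iff]
  have dF1: "(F1 has_real_derivative 0) (at x)" if "x \<in> {0<..<L}" for x
  proof (rule strong[OF w1 _ _ _ _ that])
    show "AE x in lebesgue. x \<in> {0<..<L} \<longrightarrow> G / 3 * h x ^ 3 * hx x - 1 / 2 * h x ^ 2 * sx x = F1 x"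
      using sx by eventually_elim (simp add: F1_def)
    show "AE x in lebesgue. x \<in> {0<..<L} \<longrightarrow> J1 x = 0"
      using J'(1) by eventually_elim simp
  qed (auto intro: co cF)
  have dF2: "(F2 has_real_derivative K * w x) (at x)" if "x \<in> {0<..<L}" for x
  proof (rule strong[OF w2 _ _ _ _ that])
    show "AE x in lebesgue. x \<in> {0<..<L} \<longrightarrow> G / 3 * h x ^ 2 * m x * hx x - 1 / 2 * h x * m x * sx x
               + \<delta> * mx x - \<delta> * (m x / h x) * hx x = F2 x"
      using sx by eventually_elim (simp add: F2_def)
    show "AE x in lebesgue. x \<in> {0<..<L} \<longrightarrow> J2 x = K * w x"
      using J'(2) by eventually_elim (simp add: w_def)
  qed (auto intro!: co cF cw continuous_intros)
  have dF3: "(F3 has_real_derivative - (K * w x)) (at x)" if "x \<in> {0<..<L}" for x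
  proof (rule strong[OF w3 _ _ _ _ that])
    show "AE x in lebesgue. x \<in> {0<..<L} \<longrightarrow> G / 2 * h x ^ 2 * \<Gamma> x * hx x - h x * \<Gamma> x * sx x + D * \<Gamma>x x = F3 x"
      using sx by eventually_elim (simp add: F3_def)
    show "AE x in lebesgue. x \<in> {0<..<L} \<longrightarrow> J3 x = - (K * w x)"
      using J'(3) by eventually_elim (auto simp: w_def)
  qed (auto intro!: co cF cw continuous_intros)
  have F1_0: "F1 x = 0" if "x \<in> {0..L}" for x
    using deriv_0_imp_const_on_Icc[OF \<open>L > 0\<close> cF(1) dF1 that] bdry by (simp add: F1_def)
  have rel: "G * h x * hx x = 3 / 2 * (s x * \<Gamma>x x)" if "x \<in> {0..L}" for x
  proof -
    \<comment> \<open>The factor \<open>h x ^ 2\<close> splits off from \<open>3 * F1 x\<close>;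
      being nonzero, it can be cancelled.\<close>
    have "h x ^ 2 * (G * h x * hx x - 3 / 2 * (s x * \<Gamma>x x)) = 3 * F1 x"
      by (simp add: F1_def power2_eq_square power3_eq_cube algebra_simps)
    then show ?thesis using F1_0[OF that] h0[OF that] by simp
  qed
  have F23: "F3 x = - F2 x" if "x \<in> {0..L}" for x
  proof -
    have "F2 x + F3 x = F2 0 + F3 0"
    proof (rule deriv_0_imp_const_on_Icc[OF \<open>L > 0\<close> _ _ that])
      show "((\<lambda>x. F2 x + F3 x) has_real_derivative 0) (at x)" if "x \<in> {0<..<L}" for x
        using dF2[OF that] dF3[OF that] by (auto intro!: derivative_eq_intros)
    qed (intro continuous_intros cF)
    then show ?thesis using bdry by (simp add: F2_def F3_def)
  qed
  have F2_eq: "F2 x = \<delta> * mx x - \<delta> * (m x / h x) * hx x" if "x \<in> {0..L}" for x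
  proof -
    \<comment> \<open>The first two terms of the second flux are \<open>m x / h x\<close> times the
      first flux, so \<open>rel\<close> removes them.\<close>
    have "F2 x = h x * m x / 3 * (G * h x * hx x - 3 / 2 * (s x * \<Gamma>x x)) + \<delta> * mx x - \<delta> * (m x / h x) * hx x"
      by (simp add: F2_def power2_eq_square algebra_simps)
    then show ?thesis using rel[OF that] by simp
  qed
  \<comment> \<open>By \<open>rel\<close>, the term with \<open>hx\<close> contributes
    \<open>3 / 4\<close> of \<open>h x * \<Gamma> x * s x\<close>; subtracting the full term leaves
    \<open>- 1 / 4\<close>.\<close>
  define A where "A x = D - h x * \<Gamma> x * s x / 4" for x
  have A_pos: "A x > 0" if "x \<in> {0..L}" for x
  proof -
    have "h x * \<Gamma> x * s x \<le> 0"
      using p[OF that] s_nonpos by (intro mult_nonneg_nonpos) auto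
    then show ?thesis using pos by (simp add: A_def)
  qed
  have F3_eq: "F3 x = A x * \<Gamma>x x" if "x \<in> {0..L}" for x
  proof -
    have "F3 x = h x * \<Gamma> x / 2 * (G * h x * hx x) - h x * \<Gamma> x * (s x * \<Gamma>x x) + D * \<Gamma>x x"
      by (simp add: F3_def power2_eq_square algebra_simps)
    then show ?thesis unfolding rel[OF that] by (simp add: A_def algebra_simps)
  qed
  \<comment> \<open>The first summand of the coefficient comes from
    \<open>F2 = \<delta> * h * (m / h)'\<close>, the second from
    \<open>\<Gamma>x = F3 / A = - F2 / A\<close>.\<close>
  have dw: "(w has_real_derivative (\<beta> / (\<delta> * h x) + 1 / A x) * F2 x) (at x)" if "x \<in> {0<..<L}" for x
  proof -
    have x: "x \<in> {0..L}" using that by auto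
    have "(w has_real_derivative \<beta> * (mx x * h x - m x * hx x) / (h x * h x) - \<Gamma>x x) (at x)"
      unfolding w_def using h0[OF x] dh[OF that] dm[OF that] d\<Gamma>[OF that]
      by (auto intro!: derivative_eq_intros simp: field_simps)
    moreover have "\<beta> * (mx x * h x - m x * hx x) / (h x * h x) = \<beta> / (\<delta> * h x) * F2 x"
      unfolding F2_eq[OF x] using h0[OF x] pos by (simp add: field_simps)
    moreover have "\<Gamma>x x = - (1 / A x * F2 x)"
      using F3_eq[OF x] F23[OF x] A_pos[OF x] by (simp add: field_simps)
    ultimately show ?thesis by (simp add: algebra_simps)
  qed
  have b_nonneg: "\<beta> / (\<delta> * h x) + 1 / A x \<ge> 0" if "x \<in> {0<..<L}" for x
    using p(1)[of x] A_pos[of x] pos that by simp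
  have "F2 0 = 0" "F2 L = 0" using bdry by (simp_all add: F2_def)
  from flux_system_trivial[OF \<open>L > 0\<close> \<open>K > 0\<close> cF(2) cw dF2 dw b_nonneg this]
  have zero: "F2 x = 0" "w x = 0" if "x \<in> {0<..<L}" for x
    using that by blast+
  have \<Gamma>x0: "\<Gamma>x x = 0" if "x \<in> {0<..<L}" for x
    using F3_eq[of x] F23[of x] zero(1)[OF that] A_pos[of x] that by auto
  have hx0: "hx x = 0" if "x \<in> {0<..<L}" for x
    using rel[of x] \<Gamma>x0[OF that] h0[of x] pos that by auto
  have mx0: "mx x = 0" if "x \<in> {0<..<L}" for x
    using F2_eq[of x] zero(1)[OF that] hx0[OF that] pos that by auto
  have const: "h x = h 0 \<and> m x = m 0 \<and> \<Gamma> x = \<Gamma> 0" if "x \<in> {0..L}" for x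
    using deriv_0_imp_const_on_Icc[OF \<open>L > 0\<close> c(1) _ that]
      deriv_0_imp_const_on_Icc[OF \<open>L > 0\<close> c(2) _ that]
      deriv_0_imp_const_on_Icc[OF \<open>L > 0\<close> c(3) _ that]
      dh dm d\<Gamma> hx0 mx0 \<Gamma>x0 by metis
  \<comment> \<open>The vanishing of \<open>w\<close> is available in the open interval only, so it
    is evaluated at the midpoint and carried to 0 by constancy.\<close>
  have "w (L / 2) = 0" using zero(2)[of "L / 2"] pos by auto
  moreover have "h (L / 2) = h 0 \<and> m (L / 2) = m 0 \<and> \<Gamma> (L / 2) = \<Gamma> 0"
    using pos by (intro const) auto
  ultimately have "m 0 = h 0 * \<Gamma> 0 / \<beta>"
    using h0[of 0] pos by (simp add: w_def field_simps)
  then show "h x = h 0" "m x = h 0 * \<Gamma> 0 / \<beta>" "\<Gamma> x = \<Gamma> 0"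
    using const[OF x] by auto
qed

text \<open>A positive derivative would force an increase just to the right of \<open>x\<close>.
  Strict decrease still allows a zero derivative, hence the weak inequality.\<close>

lemma strict_antimono_deriv_nonpos:
  fixes f :: "real \<Rightarrow> real"
  assumes "strict_antimono_on UNIV f" "(f has_real_derivative d) (at x)"
  shows "d \<le> 0"
proof (rule ccontr)
  assume "\<not> d \<le> 0"
  then obtain e where "e > 0" "\<And>h. h > 0 \<Longrightarrow> h < e \<Longrightarrow> f x < f (x + h)"
    using DERIV_pos_inc_right[OF assms(2)] by auto
  then have "f x < f (x + e / 2)" by simp
  moreover have "f (x + e / 2) < f x"
    using assms(1) \<open>e > 0\<close> by (simp add: monotone_on_def)
  ultimately show False by simp
qed

theorem corollary3p3:
  fixes L G D \<delta> \<beta> K :: real and \<sigma> h m \<Gamma> :: "real \<Rightarrow> real"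
  assumes "L > 0" and "G > 0" and "D > 0" and "\<delta> > 0" and "\<beta> > 0" and "K > 0"
    and "C_k 2 \<sigma>" and "strict_antimono_on UNIV \<sigma>"
  shows "steady_state L G D \<delta> \<beta> K \<sigma> h m \<Gamma> \<longleftrightarrow>
    (\<exists>hs ms \<Gamma>s. hs > 0 \<and> ms = hs * \<Gamma>s / \<beta> \<and> ms > 0 \<and>
       (\<forall>x\<in>{0..L}. h x = hs \<and> m x = ms \<and> \<Gamma> x = \<Gamma>s))"
proof
  assume st: "steady_state L G D \<delta> \<beta> K \<sigma> h m \<Gamma>"
  \<comment> \<open>The cases \<open>j = 0\<close> and \<open>j = 1\<close> of \<open>C_k 2\<close>
    make \<open>\<sigma>\<close> differentiable and \<open>deriv \<sigma>\<close> differentiable,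
    hence continuous.\<close>
  have "(deriv ^^ 0) \<sigma> differentiable_on UNIV" "(deriv ^^ 1) \<sigma> differentiable_on UNIV"
    using assms(7) unfolding C_k_def by (metis one_less_numeral_iff semiring_norm(76) zero_less_numeral)+
  then have \<sigma>: "(\<sigma> has_real_derivative deriv \<sigma> x) (at x)" "continuous_on UNIV (deriv \<sigma>)" for x
    by (auto simp: differentiable_on_def DERIV_deriv_iff_real_differentiable
      intro: differentiable_imp_continuous_on[unfolded differentiable_on_def])
  have "deriv \<sigma> x \<le> 0" for x
    by (rule strict_antimono_deriv_nonpos[OF assms(8) \<sigma>(1)])
  note const = steady_state_imp_const[OF assms(1-6) \<sigma> this st]
  \<comment> \<open>The values at 0 serve as the constants \<open>hs\<close>, \<open>ms\<close> and
    \<open>\<Gamma>s\<close>; their positivity is part of being a steady state.\<close>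
  have "h 0 > 0" "m 0 > 0" using st \<open>L > 0\<close> by (auto simp: steady_state_def)
  moreover have "m 0 = h 0 * \<Gamma> 0 / \<beta>" using const(2)[of 0] \<open>L > 0\<close> by simp
  ultimately show "\<exists>hs ms \<Gamma>s. hs > 0 \<and> ms = hs * \<Gamma>s / \<beta> \<and> ms > 0 \<and>
       (\<forall>x\<in>{0..L}. h x = hs \<and> m x = ms \<and> \<Gamma> x = \<Gamma>s)"
    using const by metis
next
  assume "\<exists>hs ms \<Gamma>s. hs > 0 \<and> ms = hs * \<Gamma>s / \<beta> \<and> ms > 0 \<and>
       (\<forall>x\<in>{0..L}. h x = hs \<and> m x = ms \<and> \<Gamma> x = \<Gamma>s)"
  then show "steady_state L G D \<delta> \<beta> K \<sigma> h m \<Gamma>"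
    using steady_state_const[OF assms(1,5)] by blast
qed

end
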